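(* (a) Let $V$ be a complete discrete valuation ring of mixed characteristic $p$ with maximal ideal $pV$, let $R=V[[X_1,\dots,X_{n-1}]]$, and let $B$ be an integral extension of $R$ contained in an algebraic field extension of $Q(R)$. Let $A$ be the absolute integral closure of $V$. If for some $c\in B$, $c\ne0$, and some $b\in B\setminus V$ the element $c\,db\in\Omega_{B/V}$ is a torsion element, then $b\in A\cap B$. (b) Let $k$ be a field of characteristic $0$, let $R=k[[X_1,\dots,X_n]]$ or $R=k[X_1,\dots,X_n]$, and let $B$ be an integral extension of $R$ contained in an algebraic field extension of $Q(R)$. Let $\bar k$ be the algebraic closure of $k$ in $Q(B)$. Then for every $b\in B\setminus\bar k$, the element $db\in\Omega_{B/k}$ is torsion-free over $B$.
   Context: $Q(S)$ denotes the fraction field of a domain $S$; $\Omega$ denotes modules of Kähler differentials (not completed). The absolute integral closure of $V$ is its integral closure in an algebraic closure of its fraction field (taken compatibly inside an algebraic closure of $Q(B)$), so $A\cap B$ is the set of elements of $B$ integral over $V$. An element $w$ of a module over a domain $B$ is torsion if $c'w=0$ for some nonzero $c'\in B$; it is torsion-free if $c'w\neq0$ for every nonzero $c'\in B$. *)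

theory Defs
  imports
    "HOL-Library.Poly_Mapping"
    "HOL-Algebra.Algebraic_Closure_Type"
    "HOL-Algebra.Ideal_Product"
begin

text \<open>
  All rings of the statement (\<open>V\<close>, \<open>k\<close>, \<open>R\<close>, \<open>B\<close> and the fraction fields) are subsets of one
  ambient field, given as a type; so inclusions and intersections such as \<open>A \<inter> B\<close> are literal.
  \<open>ring_on S\<close> is the ring structure that the ambient type induces on \<open>S\<close>.
\<close>

abbreviation ring_on :: "'a::ring_1 set \<Rightarrow> 'a ring" where
  "ring_on S \<equiv> ring_of_type_algebra\<lparr>carrier := S\<rparr>"

lemma ring_on_simps [simp]:
  "carrier (ring_on S) = S" "monoid.mult (ring_on S) = (*)" "monoid.one (ring_on S) = 1"
  "ring.zero (ring_on S) = 0" "ring.add (ring_on S) = (+)"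
  by (auto simp: ring_of_type_algebra_def)

lemma subring_type_algebra_iff:
  fixes S :: "'a::comm_ring_1 set"
  shows "subring S ring_of_type_algebra \<longleftrightarrow>
    1 \<in> S \<and> (\<forall>x\<in>S. - x \<in> S) \<and> (\<forall>x\<in>S. \<forall>y\<in>S. x + y \<in> S \<and> x * y \<in> S)"
proof -
  let ?T = "ring_of_type_algebra :: 'a ring"
  interpret T: ring ?T by rule
  have simps: "carrier ?T = UNIV" "monoid.mult ?T = (*)" "monoid.one ?T = 1" "ring.zero ?T = 0" "ring.add ?T = (+)"
    by (auto simp: ring_of_type_algebra_def)
  have inv: "a_inv ?T x = - x" for x
    using T.minus_equality[of "- x" x] by (simp add: simps)
  show ?thesis
  proof
    assume s: "subring S ?T"
    show "1 \<in> S \<and> (\<forall>x\<in>S. - x \<in> S) \<and> (\<forall>x\<in>S. \<forall>y\<in>S. x + y \<in> S \<and> x * y \<in> S)"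
      using subringE[OF s] by (auto simp: simps inv)
  next
    assume *: "1 \<in> S \<and> (\<forall>x\<in>S. - x \<in> S) \<and> (\<forall>x\<in>S. \<forall>y\<in>S. x + y \<in> S \<and> x * y \<in> S)"
    show "subring S ?T"
      by (rule T.subringI) (use * in \<open>auto simp: simps inv\<close>)
  qed
qed

lemma cring_ring_on:
  fixes S :: "'a::comm_ring_1 set"
  assumes "subring S ring_of_type_algebra"
  shows "cring (ring_on S)"
proof -
  interpret T: cring "ring_of_type_algebra :: 'a ring" by rule
  show ?thesis
    using T.subcring_iff[of S] T.subcringI'[OF assms] by (simp add: ring_of_type_algebra_def)
qed


section \<open>Complete discrete valuation rings of mixed characteristic\<close>

definition discrete_valuation_ring :: "('a, 'm) ring_scheme \<Rightarrow> bool" where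
  "discrete_valuation_ring R \<longleftrightarrow>
     principal_domain R \<and> (\<exists>!M. maximalideal M R) \<and> \<not> field R"

definition adic_complete :: "('a, 'm) ring_scheme \<Rightarrow> 'a set \<Rightarrow> bool" where
  "adic_complete R I \<longleftrightarrow>
     (\<Inter>i::nat. I [^]\<^bsub>ideals_set R\<^esub> i) = {\<zero>\<^bsub>R\<^esub>} \<and>
     (\<forall>s::nat \<Rightarrow> 'a. range s \<subseteq> carrier R \<longrightarrow>
        (\<forall>i::nat. \<exists>N. \<forall>m\<ge>N. \<forall>n\<ge>N. s m \<ominus>\<^bsub>R\<^esub> s n \<in> I [^]\<^bsub>ideals_set R\<^esub> i) \<longrightarrow>
        (\<exists>l\<in>carrier R. \<forall>i::nat. \<exists>N. \<forall>n\<ge>N. s n \<ominus>\<^bsub>R\<^esub> l \<in> I [^]\<^bsub>ideals_set R\<^esub> i))"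

definition complete_dvr :: "('a, 'm) ring_scheme \<Rightarrow> bool" where
  "complete_dvr R \<longleftrightarrow>
     discrete_valuation_ring R \<and> (\<forall>M. maximalideal M R \<longrightarrow> adic_complete R M)"

text \<open>The first condition on \<open>m\<close> says that \<open>R\<close> has characteristic \<open>0\<close>, the second one that its
  residue field has characteristic \<open>p\<close>.\<close>

definition mixed_characteristic :: "('a, 'm) ring_scheme \<Rightarrow> nat \<Rightarrow> bool" where
  "mixed_characteristic R p \<longleftrightarrow>
     Factorial_Ring.prime p \<and>
     (\<forall>m::nat. [m] \<cdot>\<^bsub>R\<^esub> \<one>\<^bsub>R\<^esub> = \<zero>\<^bsub>R\<^esub> \<longleftrightarrow> m = 0) \<and>
     (\<forall>M. maximalideal M R \<longrightarrow> (\<forall>m::nat. [m] \<cdot>\<^bsub>R\<^esub> \<one>\<^bsub>R\<^esub> \<in> M \<longleftrightarrow> p dvd m))"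


section \<open>Power series and polynomial rings in \<open>n\<close> variables\<close>

text \<open>
  The variables are indexed by \<open>{..<n}\<close>, monomials are exponent vectors of type \<^typ>\<open>nat \<Rightarrow>\<^sub>0 nat\<close>,
  and a power series is its coefficient function.
\<close>

definition mps_mult ::
    "((nat \<Rightarrow>\<^sub>0 nat) \<Rightarrow> 'a::comm_ring_1) \<Rightarrow> ((nat \<Rightarrow>\<^sub>0 nat) \<Rightarrow> 'a) \<Rightarrow> (nat \<Rightarrow>\<^sub>0 nat) \<Rightarrow> 'a" where
  "mps_mult f g m = (\<Sum>(a, b) \<in> {(a, b). a + b = m}. f a * g b)"

definition mps_const :: "'a::comm_ring_1 \<Rightarrow> (nat \<Rightarrow>\<^sub>0 nat) \<Rightarrow> 'a" where
  "mps_const c m = (if m = 0 then c else 0)"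

definition power_series_ring ::
    "nat \<Rightarrow> 'a::comm_ring_1 set \<Rightarrow> ((nat \<Rightarrow>\<^sub>0 nat) \<Rightarrow> 'a) ring" where
  "power_series_ring n V =
     \<lparr>carrier = {f. \<forall>m. f m \<in> V \<and> (f m \<noteq> 0 \<longrightarrow> Poly_Mapping.keys m \<subseteq> {..<n})},
      monoid.mult = mps_mult, monoid.one = mps_const 1,
      ring.zero = (\<lambda>_. 0), ring.add = (\<lambda>f g m. f m + g m)\<rparr>"

lemma finite_monomial_splits: "finite {(a, b :: nat \<Rightarrow>\<^sub>0 nat). a + b = m}"
proof -
  let ?s = "\<Sum>x\<in>Poly_Mapping.keys m. Poly_Mapping.lookup m x"
  let ?F = "{f. \<forall>x. (x \<in> Poly_Mapping.keys m \<longrightarrow> f x \<in> {..?s})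
              \<and> (x \<notin> Poly_Mapping.keys m \<longrightarrow> f x = 0)}"
  have fin: "finite ?F"
    by (rule finite_set_of_finite_funs) auto
  have "Poly_Mapping.lookup a \<in> ?F" if "a + b = m" for a b
  proof -
    have le: "Poly_Mapping.lookup a x \<le> Poly_Mapping.lookup m x" for x
      using that by (auto simp: lookup_add)
    have "Poly_Mapping.lookup m x \<le> ?s" if "x \<in> Poly_Mapping.keys m" for x
      using that by (intro member_le_sum) auto
    moreover have "Poly_Mapping.lookup m x = 0" if "x \<notin> Poly_Mapping.keys m" for x
      using that by (simp add: in_keys_iff)
    ultimately show ?thesis
      using le by (auto intro: order_trans) (metis le_zero_eq)
  qed
  hence "Poly_Mapping.lookup ` {a. \<exists>b. a + b = m} \<subseteq> ?F" by auto
  hence "finite (Poly_Mapping.lookup ` {a. \<exists>b. a + b = m})"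
    using fin finite_subset by blast
  hence "finite {a. \<exists>b. a + b = m}"
    by (rule finite_imageD) (auto intro!: inj_onI intro: poly_mapping_eqI)
  moreover have "{(a, b). a + b = m} \<subseteq> (\<lambda>a. (a, m - a)) ` {a. \<exists>b. a + b = m}"
    by (auto simp: image_iff)
  ultimately show ?thesis by (meson finite_imageI finite_subset)
qed

lemma mps_mult_commute: "mps_mult f g = mps_mult g f"
proof
  fix m
  show "mps_mult f g m = mps_mult g f m"
    unfolding mps_mult_def
    by (rule sum.reindex_bij_witness[of _ prod.swap prod.swap]) (auto simp: ac_simps)
qed

lemma mps_mult_assoc: "mps_mult (mps_mult f g) h = mps_mult f (mps_mult g h)"
proof
  fix m :: "nat \<Rightarrow>\<^sub>0 nat"
  let ?P = "\<lambda>m :: nat \<Rightarrow>\<^sub>0 nat. {(a, b). a + b = m}"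
  have "mps_mult (mps_mult f g) h m =
      (\<Sum>z\<in>?P m. \<Sum>y\<in>?P (fst z). f (fst y) * g (snd y) * h (snd z))"
    by (simp add: mps_mult_def sum_distrib_right case_prod_unfold)
  also have "\<dots> = (\<Sum>(z, y)\<in>Sigma (?P m) (\<lambda>z. ?P (fst z)). f (fst y) * g (snd y) * h (snd z))"
    by (rule sum.Sigma) (auto simp: finite_monomial_splits)
  also have "\<dots> = (\<Sum>(z, y)\<in>Sigma (?P m) (\<lambda>z. ?P (snd z)). f (fst z) * (g (fst y) * h (snd y)))"
    by (rule sum.reindex_bij_witness[of _
          "\<lambda>(z, y). ((fst z + fst y, snd y), (fst z, fst y))"
          "\<lambda>(z, y). ((fst y, snd y + snd z), (snd y, snd z))"])
       (auto simp: ac_simps)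
  also have "\<dots> = (\<Sum>z\<in>?P m. \<Sum>y\<in>?P (snd z). f (fst z) * (g (fst y) * h (snd y)))"
    by (rule sum.Sigma [symmetric]) (auto simp: finite_monomial_splits)
  also have "\<dots> = mps_mult f (mps_mult g h) m"
    by (simp add: mps_mult_def sum_distrib_left case_prod_unfold)
  finally show "mps_mult (mps_mult f g) h m = mps_mult f (mps_mult g h) m" .
qed

lemma mps_mult_const: "mps_mult (mps_const c) g = (\<lambda>m. c * g m)"
proof
  fix m :: "nat \<Rightarrow>\<^sub>0 nat"
  have "mps_mult (mps_const c) g m = (\<Sum>(a, b)\<in>{(0, m)}. mps_const c a * g b)"
    unfolding mps_mult_def
    by (rule sum.mono_neutral_right) (auto simp: finite_monomial_splits mps_const_def split: if_splits)
  thus "mps_mult (mps_const c) g m = c * g m" by (simp add: mps_const_def)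
qed

lemma mps_mult_add: "mps_mult (\<lambda>m. f m + g m) h = (\<lambda>m. mps_mult f h m + mps_mult g h m)"
  by (auto simp: mps_mult_def case_prod_unfold distrib_right sum.distrib)

lemma cring_power_series_ring:
  fixes V :: "'a::comm_ring_1 set"
  assumes V: "subring V ring_of_type_algebra"
  shows "cring (power_series_ring n V)"
proof -
  let ?P = "power_series_ring n V"
  have V0: "0 \<in> V"
    using subringE(2)[OF V] by (simp add: ring_of_type_algebra_def)
  have Vs: "1 \<in> V" "x \<in> V \<Longrightarrow> - x \<in> V" "x \<in> V \<Longrightarrow> y \<in> V \<Longrightarrow> x + y \<in> V"
    "x \<in> V \<Longrightarrow> y \<in> V \<Longrightarrow> x * y \<in> V" for x y
    using V unfolding subring_type_algebra_iff by auto
  have Vsum: "(\<And>x. x \<in> A \<Longrightarrow> u x \<in> V) \<Longrightarrow> sum u A \<in> V" for u :: "'c \<Rightarrow> 'a" and A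
    by (induction A rule: infinite_finite_induct) (auto simp: V0 Vs)
  have keys_le: "Poly_Mapping.keys (a + b) = Poly_Mapping.keys a \<union> Poly_Mapping.keys b"
    for a b :: "nat \<Rightarrow>\<^sub>0 nat"
    by (auto simp: in_keys_iff lookup_add)
  have mult: "mps_mult f g \<in> carrier ?P" if "f \<in> carrier ?P" "g \<in> carrier ?P" for f g
  proof -
    have "mps_mult f g m \<in> V" for m
      unfolding mps_mult_def using that
      by (intro Vsum) (auto simp: power_series_ring_def intro!: Vs)
    moreover have "Poly_Mapping.keys m \<subseteq> {..<n}" if nz: "mps_mult f g m \<noteq> 0" for m
    proof -
      obtain a b where ab: "a + b = m" "f a * g b \<noteq> 0"
        using nz unfolding mps_mult_def by (auto elim!: sum.not_neutral_contains_not_neutral)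
      hence "f a \<noteq> 0" "g b \<noteq> 0" by auto
      thus ?thesis
        using ab \<open>f \<in> carrier ?P\<close> \<open>g \<in> carrier ?P\<close> keys_le[of a b]
        unfolding power_series_ring_def by auto
    qed
    ultimately show ?thesis by (simp add: power_series_ring_def)
  qed
  have grp: "abelian_group ?P"
  proof (rule abelian_groupI)
    fix f g assume fg: "f \<in> carrier ?P" "g \<in> carrier ?P"
    have "Poly_Mapping.keys m \<subseteq> {..<n}" if "f m + g m \<noteq> 0" for m
    proof -
      from that have "f m \<noteq> 0 \<or> g m \<noteq> 0" by auto
      thus ?thesis using fg by (auto simp: power_series_ring_def)
    qed
    thus "f \<oplus>\<^bsub>?P\<^esub> g \<in> carrier ?P"
      using fg by (simp add: power_series_ring_def Vs(3))
  next
    fix f assume "f \<in> carrier ?P"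
    thus "\<exists>g\<in>carrier ?P. g \<oplus>\<^bsub>?P\<^esub> f = \<zero>\<^bsub>?P\<^esub>"
      by (intro bexI[of _ "\<lambda>m. - f m"]) (auto simp: power_series_ring_def Vs)
  qed (auto simp: power_series_ring_def V0 ac_simps)
  have mon: "comm_monoid ?P"
  proof (rule comm_monoidI)
    show "f \<otimes>\<^bsub>?P\<^esub> g \<in> carrier ?P" if "f \<in> carrier ?P" "g \<in> carrier ?P" for f g
      using mult[OF that] by (simp add: power_series_ring_def)
    show "f \<otimes>\<^bsub>?P\<^esub> g = g \<otimes>\<^bsub>?P\<^esub> f" for f g
      unfolding power_series_ring_def by simp (rule mps_mult_commute)
  qed (auto simp: power_series_ring_def mps_mult_const mps_mult_assoc V0 Vs mps_const_def)
  show ?thesis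
    by (rule cringI[OF grp mon]) (simp add: power_series_ring_def mps_mult_add)
qed

definition polynomial_ring ::
    "nat \<Rightarrow> 'a::comm_ring_1 set \<Rightarrow> ((nat \<Rightarrow>\<^sub>0 nat) \<Rightarrow>\<^sub>0 'a) ring" where
  "polynomial_ring n k =
     ring_on {f. \<forall>m. Poly_Mapping.lookup f m \<in> k \<and>
                     (Poly_Mapping.lookup f m \<noteq> 0 \<longrightarrow> Poly_Mapping.keys m \<subseteq> {..<n})}"

text \<open>A subring \<open>R\<close> of the ambient field \<^emph>\<open>is\<close> \<open>V[[X\<^sub>1,\<dots>,X\<^sub>n]]\<close> if there is an isomorphism
  between them that is the identity on \<open>V\<close>; likewise for polynomials.\<close>

definition is_power_series_ring :: "nat \<Rightarrow> 'a::comm_ring_1 set \<Rightarrow> 'a set \<Rightarrow> bool" where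
  "is_power_series_ring n V R \<longleftrightarrow>
     (\<exists>\<iota> \<in> ring_iso (power_series_ring n V) (ring_on R). \<forall>v\<in>V. \<iota> (mps_const v) = v)"

definition is_polynomial_ring :: "nat \<Rightarrow> 'a::comm_ring_1 set \<Rightarrow> 'a set \<Rightarrow> bool" where
  "is_polynomial_ring n k R \<longleftrightarrow>
     (\<exists>\<iota> \<in> ring_iso (polynomial_ring n k) (ring_on R).
        \<forall>v\<in>k. \<iota> (Poly_Mapping.single 0 v) = v)"


section \<open>Fraction fields, algebraic and integral elements\<close>

definition frac_field :: "'a::field set \<Rightarrow> 'a set" where
  "frac_field S = {a / b | a b. a \<in> S \<and> b \<in> S \<and> b \<noteq> 0}"

definition algebraic_over :: "'a::comm_ring_1 set \<Rightarrow> 'a \<Rightarrow> bool" where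
  "algebraic_over K x \<longleftrightarrow> (\<exists>q. q \<noteq> 0 \<and> (\<forall>i. Polynomial.coeff q i \<in> K) \<and> poly q x = 0)"

definition integral_over :: "'a::comm_ring_1 set \<Rightarrow> 'a \<Rightarrow> bool" where
  "integral_over S x \<longleftrightarrow>
     (\<exists>q. Polynomial.lead_coeff q = 1 \<and> (\<forall>i. Polynomial.coeff q i \<in> S) \<and> poly q x = 0)"

text \<open>\<open>B\<close> is an integral extension of \<open>R\<close>, contained in an algebraic field extension \<open>L\<close> of
  \<open>Q(R)\<close>.\<close>

definition integral_ext_in_algebraic_field :: "'a::field set \<Rightarrow> 'a set \<Rightarrow> bool" where
  "integral_ext_in_algebraic_field R B \<longleftrightarrow>
     subring B ring_of_type_algebra \<and> R \<subseteq> B \<and> (\<forall>x\<in>B. integral_over R x) \<and>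
     (\<exists>L. subfield L ring_of_type_algebra \<and> frac_field R \<subseteq> L \<and>
          (\<forall>x\<in>L. algebraic_over (frac_field R) x) \<and> B \<subseteq> L)"

text \<open>The elements of \<open>E\<close> that are algebraic over \<open>K\<close>. If \<open>E\<close> is an algebraically closed field
  containing the field \<open>K\<close>, this is an algebraic closure of \<open>K\<close>.\<close>

definition algebraic_closure_in :: "'a::field set \<Rightarrow> 'a set \<Rightarrow> 'a set" where
  "algebraic_closure_in K E = {x\<in>E. algebraic_over K x}"

text \<open>The integral closure of \<open>V\<close> in the algebraic closure of \<open>Q(V)\<close>, the latter being taken inside
  the algebraic closure of \<open>Q(B)\<close>; the ambient field must be algebraically closed.\<close>

definition absolute_integral_closure :: "'a::alg_closed_field set \<Rightarrow> 'a set \<Rightarrow> 'a set" where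
  "absolute_integral_closure V B =
     {x \<in> algebraic_closure_in (frac_field V) (algebraic_closure_in (frac_field B) UNIV).
        integral_over V x}"


section \<open>Kaehler differentials\<close>

text \<open>
  \<open>\<Omega>\<^bsub>B/V\<^esub>\<close> is the quotient of the free \<open>B\<close>-module on the symbols \<open>d b\<close> (\<open>b \<in> B\<close>) by the submodule
  generated by \<open>d (a + b) - d a - d b\<close>, \<open>d (a b) - a d b - b d a\<close> and \<open>d v\<close> (\<open>v \<in> V\<close>). In the free
  module, \<open>c d b\<close> is \<open>Poly_Mapping.single b c\<close>.
\<close>

definition free_module :: "'a::comm_ring_1 set \<Rightarrow> ('a \<Rightarrow>\<^sub>0 'a) set" where
  "free_module B = {f. Poly_Mapping.keys f \<subseteq> B \<and> (\<forall>b. Poly_Mapping.lookup f b \<in> B)}"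

definition free_smult :: "'a::comm_ring_1 \<Rightarrow> ('a \<Rightarrow>\<^sub>0 'a) \<Rightarrow> ('a \<Rightarrow>\<^sub>0 'a)" where
  "free_smult c f = Poly_Mapping.map ((*) c) f"

inductive_set kaehler_relations :: "'a::comm_ring_1 set \<Rightarrow> 'a set \<Rightarrow> ('a \<Rightarrow>\<^sub>0 'a) set"
  for V B where
  zero: "0 \<in> kaehler_relations V B"
| add: "f \<in> kaehler_relations V B \<Longrightarrow> g \<in> kaehler_relations V B \<Longrightarrow> f + g \<in> kaehler_relations V B"
| smult: "c \<in> B \<Longrightarrow> f \<in> kaehler_relations V B \<Longrightarrow> free_smult c f \<in> kaehler_relations V B"
| d_add: "a \<in> B \<Longrightarrow> b \<in> B \<Longrightarrow>
    Poly_Mapping.single (a + b) 1 - Poly_Mapping.single a 1 - Poly_Mapping.single b 1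
      \<in> kaehler_relations V B"
| d_mult: "a \<in> B \<Longrightarrow> b \<in> B \<Longrightarrow>
    Poly_Mapping.single (a * b) 1 - Poly_Mapping.single b a - Poly_Mapping.single a b
      \<in> kaehler_relations V B"
| d_const: "v \<in> V \<Longrightarrow> Poly_Mapping.single v 1 \<in> kaehler_relations V B"

definition kaehler_class :: "'a::comm_ring_1 set \<Rightarrow> 'a set \<Rightarrow> ('a \<Rightarrow>\<^sub>0 'a) \<Rightarrow> ('a \<Rightarrow>\<^sub>0 'a) set" where
  "kaehler_class V B f = {f + r | r. r \<in> kaehler_relations V B}"

text \<open>The record type of modules extends that of rings; \<open>mult\<close> and \<open>one\<close> are irrelevant.\<close>

definition kaehler :: "'a::comm_ring_1 set \<Rightarrow> 'a set \<Rightarrow> ('a, ('a \<Rightarrow>\<^sub>0 'a) set) module" where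
  "kaehler V B =
     \<lparr>carrier = kaehler_class V B ` free_module B,
      monoid.mult = (\<lambda>_ _. undefined), monoid.one = undefined,
      ring.zero = kaehler_class V B 0,
      ring.add = (\<lambda>v w. {x + y | x y. x \<in> v \<and> y \<in> w}),
      module.smult = (\<lambda>c w. {free_smult c x + r | x r. x \<in> w \<and> r \<in> kaehler_relations V B})\<rparr>"

definition kaehler_d :: "'a::comm_ring_1 set \<Rightarrow> 'a set \<Rightarrow> 'a \<Rightarrow> ('a \<Rightarrow>\<^sub>0 'a) set" where
  "kaehler_d V B b = kaehler_class V B (Poly_Mapping.single b 1)"

text \<open>\<open>kaehler V B\<close> is a \<open>B\<close>-module and \<open>kaehler_d V B\<close> is a \<open>V\<close>-derivation into it.\<close>

lemma lookup_free_smult [simp]: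
  "Poly_Mapping.lookup (free_smult c f) b = c * Poly_Mapping.lookup f b"
  by (auto simp: free_smult_def map.rep_eq when_def)

lemma free_smult_simps:
  "free_smult c (f + g) = free_smult c f + free_smult c g"
  "free_smult (c + d) f = free_smult c f + free_smult d f"
  "free_smult (c * d) f = free_smult c (free_smult d f)"
  "free_smult 1 f = f" "free_smult c 0 = 0"
  "free_smult c (Poly_Mapping.single b a) = Poly_Mapping.single b (c * a)"
  "free_smult (- 1) f = - f"
  by (auto intro!: poly_mapping_eqI simp: lookup_add algebra_simps lookup_single when_def)

lemma kaehler_class_eqI:
  assumes "-1 \<in> B" "f - g \<in> kaehler_relations V B"
  shows "kaehler_class V B f = kaehler_class V B g"
proof -
  have sub: "kaehler_class V B f \<subseteq> kaehler_class V B g" if "f - g \<in> kaehler_relations V B" for f g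
  proof
    fix x assume "x \<in> kaehler_class V B f"
    then obtain r where r: "r \<in> kaehler_relations V B" "x = f + r"
      by (auto simp: kaehler_class_def)
    have "x = g + ((f - g) + r)" using r(2) by simp
    thus "x \<in> kaehler_class V B g"
      using kaehler_relations.add[OF that r(1)] unfolding kaehler_class_def by blast
  qed
  have "g - f \<in> kaehler_relations V B"
    using kaehler_relations.smult[OF assms] by (simp add: free_smult_simps)
  thus ?thesis using sub[OF assms(2)] sub[of g f] by blast
qed

lemma kaehler_class_eq_iff:
  assumes "-1 \<in> B"
  shows "kaehler_class V B f = kaehler_class V B g \<longleftrightarrow> f - g \<in> kaehler_relations V B"
proof
  assume "kaehler_class V B f = kaehler_class V B g"
  moreover have "f \<in> kaehler_class V B f"
    unfolding kaehler_class_def using kaehler_relations.zero by fastforce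
  ultimately show "f - g \<in> kaehler_relations V B"
    unfolding kaehler_class_def by auto
qed (rule kaehler_class_eqI[OF assms])

lemma kaehler_add_class:
  "kaehler_class V B f \<oplus>\<^bsub>kaehler V B\<^esub> kaehler_class V B g = kaehler_class V B (f + g)"
proof -
  have "\<exists>x y. f + g + r = x + y \<and> (\<exists>r. x = f + r \<and> r \<in> kaehler_relations V B) \<and>
          (\<exists>r. y = g + r \<and> r \<in> kaehler_relations V B)"
    if "r \<in> kaehler_relations V B" for r
    using that kaehler_relations.zero
    by (intro exI[of _ "f + r"] exI[of _ "g + 0"]) (auto simp: ac_simps)
  moreover have "\<exists>r''. f + r + (g + r') = f + g + r'' \<and> r'' \<in> kaehler_relations V B"
    if "r \<in> kaehler_relations V B" "r' \<in> kaehler_relations V B" for r r'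
    using kaehler_relations.add[OF that] by (intro exI[of _ "r + r'"]) (simp add: ac_simps)
  ultimately show ?thesis
    unfolding kaehler_def kaehler_class_def by auto
qed

lemma kaehler_smult_class:
  assumes "c \<in> B"
  shows "c \<odot>\<^bsub>kaehler V B\<^esub> kaehler_class V B f = kaehler_class V B (free_smult c f)"
proof -
  have "\<exists>r''. free_smult c (f + r) + r' = free_smult c f + r'' \<and> r'' \<in> kaehler_relations V B"
    if "r \<in> kaehler_relations V B" "r' \<in> kaehler_relations V B" for r r'
    using that assms
    by (intro exI[of _ "free_smult c r + r'"])
       (auto simp: free_smult_simps ac_simps intro: kaehler_relations.intros)
  moreover have "\<exists>x r'. free_smult c f + r = free_smult c x + r' \<and>
          (\<exists>r. x = f + r \<and> r \<in> kaehler_relations V B) \<and> r' \<in> kaehler_relations V B"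
    if "r \<in> kaehler_relations V B" for r
    using that kaehler_relations.zero
    by (intro exI[of _ f] exI[of _ r]) auto
  ultimately show ?thesis
    unfolding kaehler_def kaehler_class_def by auto
qed

lemma module_kaehler:
  fixes B :: "'a::comm_ring_1 set"
  assumes B: "subring B ring_of_type_algebra"
  shows "module (ring_on B) (kaehler V B)"
proof -
  let ?K = "kaehler V B" and ?F = "free_module B"
  have Bs: "1 \<in> B" "x \<in> B \<Longrightarrow> - x \<in> B" "x \<in> B \<Longrightarrow> y \<in> B \<Longrightarrow> x + y \<in> B"
    "x \<in> B \<Longrightarrow> y \<in> B \<Longrightarrow> x * y \<in> B" for x y
    using B unfolding subring_type_algebra_iff by auto
  have B0: "0 \<in> B"
    using subringE(2)[OF B] by (simp add: ring_of_type_algebra_def)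
  have F: "0 \<in> ?F" "f \<in> ?F \<Longrightarrow> g \<in> ?F \<Longrightarrow> f + g \<in> ?F"
    "c \<in> B \<Longrightarrow> f \<in> ?F \<Longrightarrow> free_smult c f \<in> ?F" for f g c
    unfolding free_module_def using B0 keys_add[of f g]
    by (auto simp: lookup_add Bs in_keys_iff subset_iff) (metis mult_zero_right)
  have carr: "carrier ?K = kaehler_class V B ` ?F" and zero: "\<zero>\<^bsub>?K\<^esub> = kaehler_class V B 0"
    by (auto simp: kaehler_def)
  have neg: "- f \<in> ?F" if "f \<in> ?F" for f
    using F(3)[OF Bs(2)[OF Bs(1)] that] by (simp add: free_smult_simps)
  have "abelian_group ?K"
  proof (rule abelian_groupI)
    fix x assume "x \<in> carrier ?K"
    then obtain f where "f \<in> ?F" "x = kaehler_class V B f" by (auto simp: carr)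
    thus "\<exists>y\<in>carrier ?K. y \<oplus>\<^bsub>?K\<^esub> x = \<zero>\<^bsub>?K\<^esub>"
      using neg by (intro bexI[of _ "kaehler_class V B (- f)"]) (auto simp: carr zero kaehler_add_class)
  qed (auto simp: carr zero kaehler_add_class F ac_simps)
  thus ?thesis
    by (intro moduleI cring_ring_on B)
       (auto simp: carr kaehler_smult_class kaehler_add_class F Bs free_smult_simps)
qed

lemma kaehler_derivation:
  assumes B: "subring B ring_of_type_algebra" and ab: "a \<in> B" "b \<in> B"
  shows "kaehler_d V B a \<in> carrier (kaehler V B)"
    and "kaehler_d V B (a + b) = kaehler_d V B a \<oplus>\<^bsub>kaehler V B\<^esub> kaehler_d V B b"
    and "kaehler_d V B (a * b) =
           a \<odot>\<^bsub>kaehler V B\<^esub> kaehler_d V B b \<oplus>\<^bsub>kaehler V B\<^esub> b \<odot>\<^bsub>kaehler V B\<^esub> kaehler_d V B a"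
    and "v \<in> V \<Longrightarrow> kaehler_d V B v = \<zero>\<^bsub>kaehler V B\<^esub>"
proof -
  have Bs: "1 \<in> B" "0 \<in> B" "-1 \<in> B"
    using B subringE(2)[OF B] unfolding subring_type_algebra_iff
    by (auto simp: ring_of_type_algebra_def)
  show "kaehler_d V B a \<in> carrier (kaehler V B)"
    using ab Bs by (auto simp: kaehler_def kaehler_d_def free_module_def lookup_single when_def)
  show "kaehler_d V B (a + b) = kaehler_d V B a \<oplus>\<^bsub>kaehler V B\<^esub> kaehler_d V B b"
    unfolding kaehler_d_def kaehler_add_class kaehler_class_eq_iff[OF Bs(3)]
    using kaehler_relations.d_add[OF ab] by (simp add: algebra_simps)
  show "kaehler_d V B (a * b) =
      a \<odot>\<^bsub>kaehler V B\<^esub> kaehler_d V B b \<oplus>\<^bsub>kaehler V B\<^esub> b \<odot>\<^bsub>kaehler V B\<^esub> kaehler_d V B a"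
    using kaehler_relations.d_mult[OF ab] ab
    by (simp add: kaehler_d_def kaehler_add_class kaehler_smult_class kaehler_class_eq_iff[OF Bs(3)]
          free_smult_simps algebra_simps)
  show "kaehler_d V B v = \<zero>\<^bsub>kaehler V B\<^esub>" if "v \<in> V"
    using kaehler_relations.d_const[OF that]
    by (simp add: kaehler_d_def kaehler_def kaehler_class_eq_iff[OF Bs(3)])
qed

definition torsion_element ::
    "('a, 'm) ring_scheme \<Rightarrow> ('a, 'b, 'n) module_scheme \<Rightarrow> 'b \<Rightarrow> bool" where
  "torsion_element R M w \<longleftrightarrow> (\<exists>c \<in> carrier R - {\<zero>\<^bsub>R\<^esub>}. c \<odot>\<^bsub>M\<^esub> w = \<zero>\<^bsub>M\<^esub>)"

definition torsion_free_element ::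
    "('a, 'm) ring_scheme \<Rightarrow> ('a, 'b, 'n) module_scheme \<Rightarrow> 'b \<Rightarrow> bool" where
  "torsion_free_element R M w \<longleftrightarrow> (\<forall>c \<in> carrier R - {\<zero>\<^bsub>R\<^esub>}. c \<odot>\<^bsub>M\<^esub> w \<noteq> \<zero>\<^bsub>M\<^esub>)"

end

theory Submission
  imports Defs
begin

text \<open>
  If \<open>b\<close> is transcendental over \<open>V\<close>, the ambient field, having characteristic \<open>0\<close>, carries a
  \<open>V\<close>-derivation \<open>D\<close> with \<open>D b = 1\<close>. It induces a map \<open>\<Omega>\<^bsub>B/V\<^esub> \<rightarrow> L\<close> which shows that \<open>c db \<noteq> 0\<close> for
  \<open>c \<noteq> 0\<close>. So torsion forces \<open>b\<close> to be algebraic over \<open>V\<close>, and part (b) is the case \<open>V = k\<close>.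

  For part (a) let \<open>f\<close> be a polynomial of minimal degree over \<open>V\<close> with \<open>f(b) = 0\<close>, and \<open>q\<close> a monic one
  over \<open>R\<close>. Their common root gives a relation \<open>f W = q U\<close> over \<open>R\<close> with \<open>U \<noteq> 0\<close> and \<open>deg U < deg f\<close>.
  The coefficient of this relation at a minimal monomial \<open>\<mu>\<close> of \<open>U\<close> is \<open>f W\<^sub>\<mu> = q\<^sub>0 U\<^sub>\<mu>\<close>, where \<open>q\<^sub>0\<close> is
  \<open>q\<close> evaluated at \<open>X = 0\<close>. As \<open>U\<^sub>\<mu>(b) \<noteq> 0\<close> by minimality of \<open>f\<close>, the monic polynomial \<open>q\<^sub>0\<close> over \<open>V\<close>
  vanishes at \<open>b\<close>.
\<close>

section \<open>Polynomials with coefficients in a subring\<close>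

definition poly_over :: "'a::comm_ring_1 set \<Rightarrow> 'a poly \<Rightarrow> bool" where
  "poly_over S p \<longleftrightarrow> (\<forall>i. Polynomial.coeff p i \<in> S)"

locale type_subring =
  fixes S :: "'a::idom set"
  assumes subring: "subring S ring_of_type_algebra"
begin

lemma closed [simp, intro]:
  "1 \<in> S" "x \<in> S \<Longrightarrow> - x \<in> S" "x \<in> S \<Longrightarrow> y \<in> S \<Longrightarrow> x + y \<in> S"
  "x \<in> S \<Longrightarrow> y \<in> S \<Longrightarrow> x * y \<in> S"
  using subring unfolding subring_type_algebra_iff by auto

lemma zero_closed [simp, intro]: "0 \<in> S"
  using closed(3)[of 1 "- 1"] by simp

lemma diff_closed [simp, intro]: "x \<in> S \<Longrightarrow> y \<in> S \<Longrightarrow> x - y \<in> S"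
  using closed(3)[of x "- y"] by simp

lemma of_nat_closed [simp, intro]: "of_nat n \<in> S"
  by (induction n) auto

lemma sum_closed [intro]: "(\<And>x. x \<in> A \<Longrightarrow> u x \<in> S) \<Longrightarrow> sum u A \<in> S"
  by (induction A rule: infinite_finite_induct) auto

lemma poly_over_diff: "poly_over S p \<Longrightarrow> poly_over S q \<Longrightarrow> poly_over S (p - q)"
  by (simp add: poly_over_def)

lemma poly_over_add: "poly_over S p \<Longrightarrow> poly_over S q \<Longrightarrow> poly_over S (p + q)"
  by (simp add: poly_over_def)

lemma poly_over_mult: "poly_over S p \<Longrightarrow> poly_over S q \<Longrightarrow> poly_over S (p * q)"
  by (auto simp: poly_over_def Polynomial.coeff_mult)

lemma poly_over_smult: "a \<in> S \<Longrightarrow> poly_over S p \<Longrightarrow> poly_over S (Polynomial.smult a p)"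
  by (simp add: poly_over_def)

lemma poly_over_monom: "a \<in> S \<Longrightarrow> poly_over S (Polynomial.monom a n)"
  by (simp add: poly_over_def)

lemma poly_over_pderiv: "poly_over S p \<Longrightarrow> poly_over S (pderiv p)"
  using closed(4)[OF of_nat_closed[of "Suc _"]] by (simp add: poly_over_def coeff_pderiv)

end

section \<open>Polynomials of least degree with a given root, and pseudo-division\<close>

text \<open>Stands in for the minimal polynomial when \<open>S\<close> is only a ring: leading
  coefficients cannot be inverted, so \<open>g\<close> need not be monic.\<close>

definition min_root_poly :: "'a::comm_ring_1 set \<Rightarrow> 'a \<Rightarrow> 'a poly \<Rightarrow> bool" where
  "min_root_poly S x g \<longleftrightarrow> poly_over S g \<and> g \<noteq> 0 \<and> poly g x = 0 \<and>
     (\<forall>h. poly_over S h \<longrightarrow> h \<noteq> 0 \<longrightarrow> poly h x = 0 \<longrightarrow> Polynomial.degree g \<le> Polynomial.degree h)"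

lemma min_root_poly_exists:
  assumes "algebraic_over S x"
  obtains g where "min_root_poly S x g"
proof -
  let ?P = "\<lambda>q. q \<noteq> 0 \<and> poly_over S q \<and> poly q x = 0"
  have "\<exists>q. ?P q" using assms by (auto simp: algebraic_over_def poly_over_def)
  then obtain g where "?P g" "\<forall>h. ?P h \<longrightarrow> Polynomial.degree g \<le> Polynomial.degree h"
    using ex_has_least_nat[of ?P _ Polynomial.degree] by blast
  thus thesis by (intro that[of g]) (auto simp: min_root_poly_def)
qed

lemma min_root_poly_degree_pos:
  fixes x :: "'a::field"
  assumes "min_root_poly S x g"
  shows "Polynomial.degree g > 0"
proof (rule ccontr)
  assume "\<not> Polynomial.degree g > 0"
  then obtain c where "g = [:c:]" by (metis degree_eq_zeroE gr0I)
  thus False using assms by (auto simp: min_root_poly_def)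
qed

text \<open>Division by \<open>g\<close> leaves a remainder of smaller degree vanishing at
  \<open>x\<close>, hence zero. As \<open>S\<close> is only a ring, powers of the leading
  coefficient of \<open>g\<close>, collected in \<open>a\<close>, replace denominators.\<close>

lemma min_root_poly_pseudo_dvd:
  fixes S :: "'a::field set"
  assumes S: "subring S ring_of_type_algebra"
    and g: "min_root_poly S x g"
    and p: "poly_over S p" "poly p x = 0"
  shows "\<exists>a w. a \<in> S \<and> a \<noteq> 0 \<and> poly_over S w \<and> Polynomial.smult a p = g * w"
  using p
proof (induction "Polynomial.degree p" arbitrary: p rule: less_induct)
  case less
  interpret type_subring S by (rule type_subring.intro) (rule S)
  show ?case
  proof (cases "p = 0")
    case True
    thus ?thesis by (intro exI[of _ 1] exI[of _ 0]) (auto simp: poly_over_def)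
  next
    case False
    hence le: "Polynomial.degree g \<le> Polynomial.degree p"
      using g less.prems by (auto simp: min_root_poly_def)
    have gS: "poly_over S g" "g \<noteq> 0" "poly g x = 0" using g by (auto simp: min_root_poly_def)
    define m where "m = Polynomial.monom (lead_coeff p) (Polynomial.degree p - Polynomial.degree g)"
    define r where "r = Polynomial.smult (lead_coeff g) p - g * m"
    have lc: "lead_coeff p \<in> S" "lead_coeff g \<in> S"
      using less.prems gS by (auto simp: poly_over_def)
    have mS: "poly_over S m" using lc by (simp add: m_def poly_over_monom)
    have rS: "poly_over S r"
      using gS lc less.prems mS by (simp add: r_def poly_over_diff poly_over_mult poly_over_smult)
    have rx: "poly r x = 0" using gS less.prems by (simp add: r_def)
    \<comment> \<open>Positive degree makes the descent strict even for \<open>r = 0\<close>, whose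
      degree is 0.\<close>
    have dp: "Polynomial.degree p > 0" using le min_root_poly_degree_pos[OF g] by simp
    have m0: "m \<noteq> 0" using False by (simp add: m_def)
    have dm: "Polynomial.degree m = Polynomial.degree p - Polynomial.degree g"
      using False by (simp add: m_def degree_monom_eq)
    have dgm: "Polynomial.degree (g * m) = Polynomial.degree p"
      using gS m0 le by (simp add: degree_mult_eq dm)
    have "Polynomial.coeff r (Polynomial.degree p) = 0"
    proof -
      have "Polynomial.coeff (g * m) (Polynomial.degree p) = lead_coeff g * lead_coeff m"
        by (metis dgm lead_coeff_mult)
      thus ?thesis using False by (simp add: r_def dm) (simp add: m_def)
    qed
    moreover have "Polynomial.degree r \<le> Polynomial.degree p"
      unfolding r_def using dgm by (intro Polynomial.degree_diff_le) auto
    ultimately have "Polynomial.degree r < Polynomial.degree p"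
      using dp by (metis leading_coeff_0_iff le_neq_implies_less Polynomial.degree_0)
    from less.hyps[OF this rS rx] obtain a w where
      aw: "a \<in> S" "a \<noteq> 0" "poly_over S w" "Polynomial.smult a r = g * w" by blast
    have "Polynomial.smult (a * lead_coeff g) p = Polynomial.smult a r + Polynomial.smult a (g * m)"
      by (simp add: r_def smult_diff_right)
    also have "\<dots> = g * (w + Polynomial.smult a m)"
      by (simp add: aw algebra_simps)
    finally show ?thesis
      using aw gS lc mS
      by (intro exI[of _ "a * lead_coeff g"] exI[of _ "w + Polynomial.smult a m"])
         (auto intro!: poly_over_add poly_over_smult)
  qed
qed

section \<open>Extension of derivations\<close>

text \<open>
  A derivation defined on a subring is represented by its graph: a subring of the dual numbers
  \<open>x + y \<epsilon>\<close> that meets the ideal \<open>(\<epsilon>)\<close> only in \<open>0\<close>.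
\<close>

locale derivation_graph =
  fixes G :: "('a::idom \<times> 'a) set"
  assumes one: "(1, 0) \<in> G"
    and uminus: "(x, y) \<in> G \<Longrightarrow> (- x, - y) \<in> G"
    and add: "(x, y) \<in> G \<Longrightarrow> (x', y') \<in> G \<Longrightarrow> (x + x', y + y') \<in> G"
    and mult: "(x, y) \<in> G \<Longrightarrow> (x', y') \<in> G \<Longrightarrow> (x * x', x * y' + x' * y) \<in> G"
    and zero_unique: "(0, y) \<in> G \<Longrightarrow> y = 0"
begin

lemma zero: "(0, 0) \<in> G"
  using add[OF one uminus[OF one]] by simp

lemma sum: "(\<And>x. x \<in> A \<Longrightarrow> (u x, v x) \<in> G) \<Longrightarrow> (sum u A, sum v A) \<in> G"
  by (induction A rule: infinite_finite_induct) (auto simp: zero add)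

lemma unique: "(x, y) \<in> G \<Longrightarrow> (x, y') \<in> G \<Longrightarrow> y = y'"
  using add[of x y "- x" "- y'"] uminus[of x y'] zero_unique[of "y - y'"] by simp

lemma subring_Domain: "subring (Domain G) ring_of_type_algebra"
  unfolding subring_type_algebra_iff using one uminus add mult by (blast elim!: DomainE)

text \<open>In other terms, \<open>P\<close> + \<open>Q\<close> \<epsilon> is a polynomial over the
  ring \<open>G\<close> of dual numbers.\<close>

definition lifts :: "'a poly \<Rightarrow> 'a poly \<Rightarrow> bool" where
  "lifts P Q \<longleftrightarrow> (\<forall>i. (Polynomial.coeff P i, Polynomial.coeff Q i) \<in> G)"

lemma lifts_exists:
  assumes "poly_over (Domain G) P"
  obtains Q where "lifts P Q"
proof -
  define D where "D s = (SOME y. (s, y) \<in> G)" for s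
  have D: "(s, D s) \<in> G" if "s \<in> Domain G" for s
    unfolding D_def using that by (auto intro: someI_ex)
  \<comment> \<open>This lets \<open>map_poly\<close> act on all coefficients, including the zero
    ones beyond the degree.\<close>
  have "D 0 = 0" using D[of 0] zero by (blast intro: zero_unique)
  hence "lifts P (map_poly D P)"
    using assms D by (simp add: lifts_def coeff_map_poly poly_over_def)
  thus thesis by (rule that)
qed

lemma lifts_uminus: "lifts P Q \<Longrightarrow> lifts (- P) (- Q)"
  by (simp add: lifts_def uminus)

lemma lifts_add: "lifts P Q \<Longrightarrow> lifts P' Q' \<Longrightarrow> lifts (P + P') (Q + Q')"
  by (simp add: lifts_def add)

lemma lifts_mult: "lifts P Q \<Longrightarrow> lifts P' Q' \<Longrightarrow> lifts (P * P') (P * Q' + P' * Q)"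
proof -
  assume PQ: "lifts P Q" "lifts P' Q'"
  have "(\<Sum>i\<le>n. Polynomial.coeff P i * Polynomial.coeff P' (n - i),
     \<Sum>i\<le>n. Polynomial.coeff P i * Polynomial.coeff Q' (n - i)
       + Polynomial.coeff P' (n - i) * Polynomial.coeff Q i) \<in> G" for n
    using PQ by (intro sum mult) (auto simp: lifts_def)
  moreover have "Polynomial.coeff (P' * Q) n =
      (\<Sum>i\<le>n. Polynomial.coeff P' (n - i) * Polynomial.coeff Q i)" for n
    unfolding mult.commute[of P' Q] by (simp only: Polynomial.coeff_mult) (simp only: mult.commute)
  ultimately show ?thesis
    by (simp add: lifts_def Polynomial.coeff_mult sum.distrib)
qed

lemma lifts_const: "(s, t) \<in> G \<Longrightarrow> lifts [:s:] [:t:]"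
  using zero by (auto simp: lifts_def coeff_pCons split: nat.split)

lemma lifts_X: "lifts [:0, 1:] 0"
  using zero one by (auto simp: lifts_def coeff_pCons split: nat.split)

lemma lifts_zero: "lifts 0 Q \<Longrightarrow> Q = 0"
  by (auto simp: lifts_def zero_unique intro!: poly_eqI)

text \<open>The value at \<open>x + y \<epsilon>\<close> of the polynomial \<open>P + Q \<epsilon>\<close> is \<open>P(x) + eps_part x y P Q \<epsilon>\<close>.\<close>

definition eps_part :: "'a \<Rightarrow> 'a \<Rightarrow> 'a poly \<Rightarrow> 'a poly \<Rightarrow> 'a" where
  "eps_part x y P Q = poly Q x + poly (pderiv P) x * y"

text \<open>The \<epsilon>-component of the fact that evaluation at a dual number is
  multiplicative.\<close>

lemma eps_part_mult:
  "eps_part x y (P * P') (P * Q' + P' * Q) = poly P x * eps_part x y P' Q' + poly P' x * eps_part x y P Q"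
  by (simp add: eps_part_def pderiv_mult algebra_simps)

text \<open>The subring of the dual numbers generated by \<open>G\<close> and \<open>x\<close> +
  \<open>y\<close> \<epsilon>.\<close>

definition adjoin :: "'a \<Rightarrow> 'a \<Rightarrow> ('a \<times> 'a) set" where
  "adjoin x y = {(poly P x, eps_part x y P Q) | P Q. lifts P Q}"

lemma adjoinI: "lifts P Q \<Longrightarrow> s = poly P x \<Longrightarrow> t = eps_part x y P Q \<Longrightarrow> (s, t) \<in> adjoin x y"
  unfolding adjoin_def by blast

lemma adjoin_superset: "G \<subseteq> adjoin x y"
proof
  fix z assume "z \<in> G"
  then obtain s t where st: "z = (s, t)" "(s, t) \<in> G" by (cases z) auto
  show "z \<in> adjoin x y"
    unfolding st(1) by (rule adjoinI[OF lifts_const[OF st(2)]]) (auto simp: eps_part_def pderiv_pCons)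
qed

lemma adjoin_mem: "(x, y) \<in> adjoin x y"
  by (rule adjoinI[OF lifts_X]) (auto simp: eps_part_def pderiv_pCons)

text \<open>The image of evaluation is always a subring of the dual numbers; the assumption is
  exactly the remaining condition, that it meets the ideal (\<epsilon>) only in 0.\<close>

lemma derivation_graph_adjoin:
  assumes "\<And>P Q. lifts P Q \<Longrightarrow> poly P x = 0 \<Longrightarrow> eps_part x y P Q = 0"
  shows "derivation_graph (adjoin x y)"
proof
  show "(1, 0) \<in> adjoin x y" using adjoin_superset one by blast
next
  fix s t assume "(s, t) \<in> adjoin x y"
  then obtain P Q where "lifts P Q" "s = poly P x" "t = eps_part x y P Q"
    by (auto simp: adjoin_def)
  thus "(- s, - t) \<in> adjoin x y"
    by (intro adjoinI[OF lifts_uminus[of P Q]]) (auto simp: eps_part_def pderiv_minus)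
next
  fix s t s' t' assume "(s, t) \<in> adjoin x y" "(s', t') \<in> adjoin x y"
  then obtain P Q P' Q' where PQ: "lifts P Q" "s = poly P x" "t = eps_part x y P Q"
    "lifts P' Q'" "s' = poly P' x" "t' = eps_part x y P' Q'"
    by (auto simp: adjoin_def)
  show "(s + s', t + t') \<in> adjoin x y"
    by (rule adjoinI[OF lifts_add[OF PQ(1,4)]])
       (auto simp: PQ eps_part_def pderiv_add algebra_simps)
  show "(s * s', s * t' + s' * t) \<in> adjoin x y"
    by (rule adjoinI[OF lifts_mult[OF PQ(1,4)]]) (simp_all only: PQ poly_mult eps_part_mult)
next
  fix t assume "(0, t) \<in> adjoin x y"
  thus "t = 0" using assms by (auto simp: adjoin_def)
qed

end

text \<open>No nonzero polynomial over the domain vanishes at \<open>x\<close>, so the value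
  \<open>y\<close> of the derivation at \<open>x\<close> can be chosen freely.\<close>

lemma (in derivation_graph) adjoin_transcendental:
  assumes "\<not> algebraic_over (Domain G) x"
  shows "derivation_graph (adjoin x y)"
proof (rule derivation_graph_adjoin)
  fix P Q assume PQ: "lifts P Q" "poly P x = 0"
  hence "\<forall>i. Polynomial.coeff P i \<in> Domain G" by (auto simp: lifts_def)
  hence "P = 0" using assms PQ by (auto simp: algebraic_over_def)
  thus "eps_part x y P Q = 0" using PQ lifts_zero[of Q] by (simp add: eps_part_def)
qed

text \<open>The value at an algebraic \<open>x\<close> has to solve the equation obtained by
  differentiating g(x) = 0, where \<open>g\<close> is of minimal degree; characteristic 0 makes it
  solvable.\<close>

lemma derivation_graph_adjoin_algebraic:
  fixes G :: "('a::field_char_0 \<times> 'a) set"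
  assumes "derivation_graph G" and alg: "algebraic_over (Domain G) x"
  shows "\<exists>y. derivation_graph (derivation_graph.adjoin G x y)"
proof -
  interpret derivation_graph G by fact
  interpret S: type_subring "Domain G" by (rule type_subring.intro) (rule subring_Domain)
  obtain g where g: "min_root_poly (Domain G) x g"
    using min_root_poly_exists[OF alg] .
  hence gS: "poly_over (Domain G) g" "poly g x = 0"
    and min: "\<And>h. poly_over (Domain G) h \<Longrightarrow> h \<noteq> 0 \<Longrightarrow> poly h x = 0 \<Longrightarrow>
                Polynomial.degree g \<le> Polynomial.degree h"
    by (auto simp: min_root_poly_def)
  have deg: "Polynomial.degree g > 0" using min_root_poly_degree_pos[OF g] .
  \<comment> \<open>In characteristic 0 the derivative is nonzero, and by its smaller degree it
    cannot vanish at \<open>x\<close>.\<close>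
  have g': "poly (pderiv g) x \<noteq> 0"
    using min[OF S.poly_over_pderiv[OF gS(1)]] deg
    by (auto simp: degree_pderiv pderiv_eq_0_iff)
  obtain h where h: "lifts g h" using lifts_exists[OF gS(1)] .
  \<comment> \<open>The unique solution of \<open>eps_part x y g h = 0\<close>.\<close>
  define y where "y = - poly h x / poly (pderiv g) x"
  have gh: "eps_part x y g h = 0" using g' by (simp add: eps_part_def y_def)
  have "derivation_graph (adjoin x y)"
  proof (rule derivation_graph_adjoin)
    fix P Q assume PQ: "lifts P Q" "poly P x = 0"
    hence "poly_over (Domain G) P" by (auto simp: lifts_def poly_over_def)
    from min_root_poly_pseudo_dvd[OF subring_Domain g this PQ(2)]
    obtain a w where aw: "a \<in> Domain G" "a \<noteq> 0" "poly_over (Domain G) w"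
        "Polynomial.smult a P = g * w" by blast
    obtain a' where a': "(a, a') \<in> G" using aw(1) by blast
    obtain w' where w': "lifts w w'" using lifts_exists[OF aw(3)] .
    \<comment> \<open>Two lifts of the polynomial a P = g w must agree; at \<open>x\<close> +
      \<open>y\<close> \<epsilon> all terms of their \<epsilon>-components vanish except
      \<open>a * eps_part x y P Q\<close>.\<close>
    let ?Q = "[:a:] * Q + P * [:a':]"
    have "lifts (g * w) ?Q" using lifts_mult[OF lifts_const[OF a'] PQ(1)] aw(4) by simp
    moreover have "lifts (g * w) (g * w' + w * h)" by (rule lifts_mult[OF h w'])
    ultimately have "?Q = g * w' + w * h"
      by (intro poly_eqI) (auto simp: lifts_def intro: unique)
    hence "eps_part x y ([:a:] * P) ?Q = eps_part x y (g * w) (g * w' + w * h)"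
      using aw(4) by simp
    hence "a * eps_part x y P Q + poly P x * eps_part x y [:a:] [:a':] =
        poly g x * eps_part x y w w' + poly w x * eps_part x y g h"
      unfolding eps_part_mult by simp
    thus "eps_part x y P Q = 0" using PQ gS gh aw(2) by simp
  qed
  thus ?thesis ..
qed

section \<open>Extending a derivation to the whole field\<close>

text \<open>Each condition concerns at most two elements, and two elements of the union of a chain
  lie in a common member.\<close>

lemma derivation_graph_Union:
  assumes C: "subset.chain {G. derivation_graph G} C" "C \<noteq> {}"
  shows "derivation_graph (\<Union>C)"
proof -
  have dg: "derivation_graph G" if "G \<in> C" for G
    using C that by (auto simp: subset.chain_def)
  have common: "\<exists>G\<in>C. u \<in> G \<and> v \<in> G" if uv: "u \<in> \<Union>C" "v \<in> \<Union>C" for u v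
  proof -
    obtain G where G: "G \<in> C" "u \<in> G" using uv(1) by (rule UnionE)
    obtain H where H: "H \<in> C" "v \<in> H" using uv(2) by (rule UnionE)
    have "G \<subseteq> H \<or> H \<subseteq> G" using C(1) G(1) H(1) by (simp add: subset_chain_def)
    thus ?thesis using G H by blast
  qed
  show ?thesis
  proof
    show "(1, 0) \<in> \<Union>C" using C(2) dg derivation_graph.one by blast
    show "(- x, - y) \<in> \<Union>C" if "(x, y) \<in> \<Union>C" for x y
      using that dg derivation_graph.uminus by blast
    show "(x + x', y + y') \<in> \<Union>C" if "(x, y) \<in> \<Union>C" "(x', y') \<in> \<Union>C" for x y x' y'
      using common[OF that] dg derivation_graph.add by blast
    show "(x * x', x * y' + x' * y) \<in> \<Union>C" if "(x, y) \<in> \<Union>C" "(x', y') \<in> \<Union>C" for x y x' y'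
      using common[OF that] dg derivation_graph.mult by blast
    show "y = 0" if "(0, y) \<in> \<Union>C" for y
      using that dg derivation_graph.zero_unique by blast
  qed
qed

text \<open>By Zorn's lemma there is a maximal graph above \<open>G\<close>; were some
  \<open>x\<close> missing from its domain, \<open>adjoin\<close> would enlarge it.\<close>

lemma derivation_graph_extends_total:
  fixes G :: "('a::field_char_0 \<times> 'a) set"
  assumes "derivation_graph G"
  obtains M where "derivation_graph M" "G \<subseteq> M" "Domain M = UNIV"
proof -
  let ?A = "{H. derivation_graph H \<and> G \<subseteq> H}"
  have "\<exists>M\<in>?A. \<forall>H\<in>?A. M \<subseteq> H \<longrightarrow> H = M"
  proof (rule subset_Zorn_nonempty)
    show "?A \<noteq> {}" using assms by blast
    fix C assume C: "C \<noteq> {}" "subset.chain ?A C"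
    hence "subset.chain {G. derivation_graph G} C" by (auto simp: subset.chain_def)
    thus "\<Union>C \<in> ?A" using C derivation_graph_Union by (auto simp: subset.chain_def)
  qed
  then obtain M where MA: "M \<in> ?A" "\<forall>H\<in>?A. M \<subseteq> H \<longrightarrow> H = M" by (rule bexE)
  hence M: "derivation_graph M" "G \<subseteq> M" by auto
  have max: "H = M" if "derivation_graph H" "M \<subseteq> H" for H
    using MA(2) M(2) that order_trans[OF M(2) that(2)] by simp
  interpret derivation_graph M by fact
  have "x \<in> Domain M" for x
  proof -
    \<comment> \<open>For transcendental \<open>x\<close> any value works, and 0 is taken.\<close>
    obtain y where "derivation_graph (adjoin x y)"
      using adjoin_transcendental[of x 0] derivation_graph_adjoin_algebraic[OF M(1), of x] by blast
    hence "adjoin x y = M" using adjoin_superset by (rule max)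
    thus ?thesis using adjoin_mem[of x y] by auto
  qed
  hence "Domain M = UNIV" by auto
  thus thesis by (rule that[OF M])
qed

text \<open>Start from the zero derivation on \<open>V\<close>, give the transcendental element
  \<open>b\<close> the value 1, and extend to the ambient field.\<close>

lemma derivation_exists:
  fixes V :: "'a::field_char_0 set"
  assumes V: "subring V ring_of_type_algebra" and b: "\<not> algebraic_over V b"
  obtains D where "D b = 1" "\<And>v. v \<in> V \<Longrightarrow> D v = 0"
    "\<And>x y. D (x + y) = D x + D y" "\<And>x y. D (x * y) = x * D y + y * D x"
proof -
  interpret V: type_subring V by (rule type_subring.intro) (rule V)
  define G where "G = {(v, 0 :: 'a) | v. v \<in> V}"
  interpret G: derivation_graph G
    by unfold_locales (auto simp: G_def)
  have "Domain G = V" by (auto simp: G_def)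
  hence "derivation_graph (G.adjoin b 1)" using b G.adjoin_transcendental by simp
  then obtain M where M: "derivation_graph M" "G.adjoin b 1 \<subseteq> M" "Domain M = UNIV"
    by (rule derivation_graph_extends_total)
  interpret M: derivation_graph M by fact
  define D where "D x = (SOME y. (x, y) \<in> M)" for x
  have D: "(x, D x) \<in> M" for x
    unfolding D_def using M(3) by (metis DomainE UNIV_I someI_ex)
  have D_eq: "D x = y" if "(x, y) \<in> M" for x y using M.unique[OF D that] .
  show thesis
  proof
    show "D b = 1" using G.adjoin_mem[of b 1] M(2) by (blast intro: D_eq)
    show "D v = 0" if "v \<in> V" for v
      using that G.adjoin_superset[of b 1] M(2) by (intro D_eq) (auto simp: G_def)
    show "D (x + y) = D x + D y" for x y by (intro D_eq M.add D)
    show "D (x * y) = x * D y + y * D x" for x y by (intro D_eq M.mult D)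
  qed
qed

section \<open>Torsion in the module of differentials\<close>

text \<open>The linear map from the free module to the ambient field that sends d x to
  \<open>D x\<close>.\<close>

definition pairing :: "('a \<Rightarrow> 'a) \<Rightarrow> ('a::comm_ring_1 \<Rightarrow>\<^sub>0 'a) \<Rightarrow> 'a" where
  "pairing D f = (\<Sum>x\<in>Poly_Mapping.keys f. Poly_Mapping.lookup f x * D x)"

lemma pairing_add: "pairing D (f + g) = pairing D f + pairing D g"
  unfolding pairing_def by (rule setsum_keys_plus_distrib) (auto simp: algebra_simps)

lemma pairing_single [simp]: "pairing D (Poly_Mapping.single x c) = c * D x"
  by (simp add: pairing_def)

lemma pairing_diff: "pairing D (f - g) = pairing D f - pairing D g"
  using pairing_add[of D "f - g" g] by simp

lemma pairing_smult: "pairing D (free_smult c f) = c * pairing D f"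
proof -
  have "pairing D (free_smult c f) =
      (\<Sum>x\<in>Poly_Mapping.keys f. Poly_Mapping.lookup (free_smult c f) x * D x)"
    unfolding pairing_def by (rule sum.mono_neutral_left) (auto simp: in_keys_iff)
  thus ?thesis by (simp add: pairing_def sum_distrib_left mult.assoc)
qed

text \<open>The derivation rules for \<open>D\<close> kill every generator, so
  \<open>pairing D\<close> factors through the module of differentials.\<close>

lemma pairing_kaehler_relations:
  assumes "f \<in> kaehler_relations V B"
    and "\<And>v. v \<in> V \<Longrightarrow> D v = 0" "\<And>x y. D (x + y) = D x + D y"
    and "\<And>x y. D (x * y) = x * D y + y * D x"
  shows "pairing D f = 0"
  using assms(1)
proof induction
  case zero
  show ?case by (simp add: pairing_def)
qed (simp_all add: pairing_add pairing_diff pairing_smult assms algebra_simps)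

text \<open>For transcendental \<open>b\<close>, the map induced by a derivation with
  \<open>D b = 1\<close> sends \<open>c\<close> d b to \<open>c\<close>, which is nonzero.\<close>

lemma kaehler_d_multiple_zero_imp_algebraic:
  fixes V B :: "'a::field_char_0 set"
  assumes V: "subring V ring_of_type_algebra" and B: "subring B ring_of_type_algebra"
    and c: "c \<in> B" "c \<noteq> 0"
    and eq: "c \<odot>\<^bsub>kaehler V B\<^esub> kaehler_d V B b = \<zero>\<^bsub>kaehler V B\<^esub>"
  shows "algebraic_over V b"
proof (rule ccontr)
  assume "\<not> algebraic_over V b"
  then obtain D where D: "D b = 1" "\<And>v. v \<in> V \<Longrightarrow> D v = 0"
    "\<And>x y. D (x + y) = D x + D y" "\<And>x y. D (x * y) = x * D y + y * D x"
    using derivation_exists[OF V] by blast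
  interpret B: type_subring B by (rule type_subring.intro) (rule B)
  have "kaehler_class V B (Poly_Mapping.single b c) = kaehler_class V B 0"
    using eq kaehler_smult_class[OF c(1), of V "Poly_Mapping.single b 1"]
    by (simp add: kaehler_d_def free_smult_simps) (simp add: kaehler_def)
  hence "Poly_Mapping.single b c \<in> kaehler_relations V B"
    using kaehler_class_eq_iff[of B V "Poly_Mapping.single b c" 0] by simp
  hence "pairing D (Poly_Mapping.single b c) = 0"
    using D(2-4) by (rule pairing_kaehler_relations)
  thus False using c D(1) by simp
qed

section \<open>Integrality over the coefficient ring of power series\<close>

text \<open>Take \<open>m'\<close> of least total degree: in \<open>a + b = m'\<close> with
  \<open>a \<noteq> 0\<close> the degree of \<open>b\<close> is smaller.\<close>

lemma monomial_minimal:
  fixes Q :: "(nat \<Rightarrow>\<^sub>0 nat) \<Rightarrow> bool"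
  assumes "Q m"
  obtains m' where "Q m'" "\<And>a b. a + b = m' \<Longrightarrow> a \<noteq> 0 \<Longrightarrow> \<not> Q b"
proof -
  define s where "s m = (\<Sum>x\<in>Poly_Mapping.keys m. Poly_Mapping.lookup m x)" for m :: "nat \<Rightarrow>\<^sub>0 nat"
  have s_add: "s (a + b) = s a + s b" for a b
    unfolding s_def by (rule setsum_keys_plus_distrib) auto
  have s_pos: "s a > 0" if "a \<noteq> 0" for a
    using that unfolding s_def by (intro sum_pos) (auto simp: in_keys_iff)
  obtain m' where m': "Q m'" "\<And>m. Q m \<Longrightarrow> s m' \<le> s m"
    using ex_has_least_nat[of Q m s] assms by blast
  show thesis
  proof (rule that[OF m'(1)])
    fix a b assume "a + b = m'" "a \<noteq> 0"
    thus "\<not> Q b" using m'(2)[of b] s_add[of a b] s_pos[of a] by auto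
  qed
qed

text \<open>\<open>\<psi> r m\<close> is the coefficient of \<open>r\<close> at the monomial
  \<open>m\<close>. The conditions make \<open>\<psi>\<close> an injective homomorphism into the
  power series over \<open>V\<close> that sends elements of \<open>V\<close> to constant
  series.\<close>

locale power_series_coeffs =
  fixes V R :: "'a::field set" and \<psi> :: "'a \<Rightarrow> (nat \<Rightarrow>\<^sub>0 nat) \<Rightarrow> 'a"
  assumes V: "subring V ring_of_type_algebra" and R: "subring R ring_of_type_algebra"
    and VR: "V \<subseteq> R"
    and coeff_in: "r \<in> R \<Longrightarrow> \<psi> r m \<in> V"
    and add: "r \<in> R \<Longrightarrow> r' \<in> R \<Longrightarrow> \<psi> (r + r') m = \<psi> r m + \<psi> r' m"
    and mult: "r \<in> R \<Longrightarrow> r' \<in> R \<Longrightarrow> \<psi> (r * r') = mps_mult (\<psi> r) (\<psi> r')"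
    and const: "v \<in> V \<Longrightarrow> \<psi> v = mps_const v"
    and inj: "r \<in> R \<Longrightarrow> (\<And>m. \<psi> r m = 0) \<Longrightarrow> r = 0"
begin

sublocale V: type_subring V by (rule type_subring.intro) (rule V)

sublocale R: type_subring R by (rule type_subring.intro) (rule R)

lemma zero [simp]: "\<psi> 0 m = 0"
  using const[of 0] by (simp add: mps_const_def)

lemma sum: "(\<And>i. i \<in> I \<Longrightarrow> u i \<in> R) \<Longrightarrow> \<psi> (sum u I) m = (\<Sum>i\<in>I. \<psi> (u i) m)"
  by (induction I rule: infinite_finite_induct) (simp_all add: add R.sum_closed)

text \<open>A polynomial over \<open>R\<close> is read as a power series whose coefficients are
  polynomials over \<open>V\<close>; this is its coefficient at \<open>m\<close>.\<close>

definition coeff_poly :: "(nat \<Rightarrow>\<^sub>0 nat) \<Rightarrow> 'a poly \<Rightarrow> 'a poly" where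
  "coeff_poly m P = map_poly (\<lambda>r. \<psi> r m) P"

lemma coeff_coeff_poly [simp]: "Polynomial.coeff (coeff_poly m P) i = \<psi> (Polynomial.coeff P i) m"
  by (simp add: coeff_poly_def coeff_map_poly)

lemma poly_over_coeff_poly: "poly_over R P \<Longrightarrow> poly_over V (coeff_poly m P)"
  by (simp add: poly_over_def coeff_in)

lemma degree_coeff_poly: "Polynomial.degree (coeff_poly m P) \<le> Polynomial.degree P"
  by (rule Polynomial.degree_le) (simp add: coeff_eq_0)

lemma coeff_poly_nonzero:
  assumes "poly_over R P" "P \<noteq> 0"
  obtains m where "coeff_poly m P \<noteq> 0"
proof -
  have "lead_coeff P \<in> R" "lead_coeff P \<noteq> 0" using assms by (auto simp: poly_over_def)
  then obtain m where "\<psi> (lead_coeff P) m \<noteq> 0" using inj by blast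
  hence "coeff_poly m P \<noteq> 0" using coeff_coeff_poly by (metis Polynomial.coeff_0)
  thus thesis by (rule that)
qed

lemma coeff_poly_const_mult:
  assumes "poly_over V f" "poly_over R W"
  shows "coeff_poly m (f * W) = f * coeff_poly m W"
proof (rule poly_eqI)
  fix j
  have fR: "Polynomial.coeff f i \<in> R" "Polynomial.coeff f i \<in> V" "Polynomial.coeff W i \<in> R" for i
    using assms VR by (auto simp: poly_over_def)
  show "Polynomial.coeff (coeff_poly m (f * W)) j = Polynomial.coeff (f * coeff_poly m W) j"
    using fR by (simp add: Polynomial.coeff_mult sum mult const mps_mult_const)
qed

text \<open>In the convolution at \<open>m\<close>, every splitting other than \<open>0 + m\<close>
  meets a vanishing coefficient of \<open>U\<close>, by minimality of \<open>m\<close>.\<close>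

lemma coeff_poly_mult_minimal:
  assumes "poly_over R q" "poly_over R U"
    and min: "\<And>a b. a + b = m \<Longrightarrow> a \<noteq> 0 \<Longrightarrow> coeff_poly b U = 0"
  shows "coeff_poly m (q * U) = coeff_poly 0 q * coeff_poly m U"
proof (rule poly_eqI)
  fix j
  have mem: "Polynomial.coeff q i \<in> R" "Polynomial.coeff U i \<in> R" for i
    using assms by (auto simp: poly_over_def)
  have U0: "\<psi> (Polynomial.coeff U i) b = 0" if "a + b = m" "a \<noteq> 0" for a b i
    using min[OF that] coeff_coeff_poly[of b U i] by simp
  have "mps_mult f (\<psi> (Polynomial.coeff U i)) m = f 0 * \<psi> (Polynomial.coeff U i) m" for f i
  proof -
    have "mps_mult f (\<psi> (Polynomial.coeff U i)) m =
        (\<Sum>(a, b)\<in>{(0, m)}. f a * \<psi> (Polynomial.coeff U i) b)"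
      unfolding mps_mult_def
    proof (rule sum.mono_neutral_right)
      show "\<forall>z\<in>{(a, b). a + b = m} - {(0, m)}.
          (case z of (a, b) \<Rightarrow> f a * \<psi> (Polynomial.coeff U i) b) = 0"
      proof
        fix z assume "z \<in> {(a, b). a + b = m} - {(0, m)}"
        then obtain a b where "z = (a, b)" "a + b = m" "a \<noteq> 0" by force
        thus "(case z of (a, b) \<Rightarrow> f a * \<psi> (Polynomial.coeff U i) b) = 0" using U0 by simp
      qed
    qed (auto simp: finite_monomial_splits)
    thus ?thesis by simp
  qed
  thus "Polynomial.coeff (coeff_poly m (q * U)) j = Polynomial.coeff (coeff_poly 0 q * coeff_poly m U) j"
    using mem by (simp add: Polynomial.coeff_mult sum mult)
qed

lemma integral_over_coefficients:
  assumes alg: "algebraic_over V b" and int: "integral_over R b"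
  shows "integral_over V b"
proof -
  obtain q where q: "lead_coeff q = 1" "poly_over R q" "poly q b = 0"
    using int by (auto simp: integral_over_def poly_over_def)
  obtain f where f: "min_root_poly V b f" using min_root_poly_exists[OF alg] .
  hence fV: "poly_over V f" "f \<noteq> 0" "poly f b = 0" by (auto simp: min_root_poly_def)
  hence fR: "poly_over R f" using VR by (auto simp: poly_over_def)
  have "algebraic_over R b" using fR fV by (auto simp: algebraic_over_def poly_over_def)
  \<comment> \<open>Since \<open>R\<close> contains \<open>V\<close>, \<open>g\<close> may have
    smaller degree than \<open>f\<close>; up to scalars \<open>f\<close> and \<open>q\<close> are
    both multiples of \<open>g\<close>.\<close>
  then obtain g where g: "min_root_poly R b g" using min_root_poly_exists by blast
  obtain a u where u: "a \<in> R" "a \<noteq> 0" "poly_over R u" "Polynomial.smult a f = g * u"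
    using min_root_poly_pseudo_dvd[OF R g fR fV(3)] by blast
  obtain a' w where w: "a' \<in> R" "a' \<noteq> 0" "poly_over R w" "Polynomial.smult a' q = g * w"
    using min_root_poly_pseudo_dvd[OF R g q(2,3)] by blast
  \<comment> \<open>Multiplying crosswise: \<open>f * W\<close> and \<open>q * U\<close> both equal
    \<open>g * u * w\<close>.\<close>
  define U where "U = Polynomial.smult a' u"
  define W where "W = Polynomial.smult a w"
  have UW: "poly_over R U" "poly_over R W"
    using u w by (auto simp: U_def W_def R.poly_over_smult)
  have "f * W = Polynomial.smult a f * w" by (simp add: W_def)
  also have "\<dots> = Polynomial.smult a' q * u" by (simp only: u w ac_simps)
  finally have fW: "f * W = q * U" by (simp add: U_def)
  have gu: "g * u \<noteq> 0" using u(2) fV(2) u(4)[symmetric] by simp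
  hence U0: "U \<noteq> 0" using w(2) by (auto simp: U_def)
  have "Polynomial.degree f = Polynomial.degree g + Polynomial.degree u"
    using gu u(2) arg_cong[OF u(4), of Polynomial.degree] by (simp add: degree_mult_eq)
  \<comment> \<open>The factor \<open>g\<close> has positive degree, which makes the inequality
    strict.\<close>
  hence degU: "Polynomial.degree U < Polynomial.degree f"
    using w(2) min_root_poly_degree_pos[OF g] by (simp add: U_def)
  obtain m where m: "coeff_poly m U \<noteq> 0"
    and m_min: "\<And>a b. a + b = m \<Longrightarrow> a \<noteq> 0 \<Longrightarrow> \<not> coeff_poly b U \<noteq> 0"
    using coeff_poly_nonzero[OF UW(1) U0] monomial_minimal[of "\<lambda>m. coeff_poly m U \<noteq> 0"] by metis
  have "f * coeff_poly m W = coeff_poly 0 q * coeff_poly m U"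
    using coeff_poly_const_mult[OF fV(1) UW(2), of m] coeff_poly_mult_minimal[OF q(2) UW(1), of m]
      m_min fW by auto
  hence "poly (coeff_poly 0 q) b * poly (coeff_poly m U) b = 0"
    using fV(3) by (metis mult_zero_left poly_mult)
  \<comment> \<open>A nonzero polynomial over \<open>V\<close> of degree below that of
    \<open>f\<close> cannot vanish at \<open>b\<close>.\<close>
  moreover have "poly (coeff_poly m U) b \<noteq> 0"
    using f m poly_over_coeff_poly[OF UW(1)] degree_coeff_poly[of m U] degU
    unfolding min_root_poly_def by (metis le_trans not_less)
  ultimately have root: "poly (coeff_poly 0 q) b = 0" by simp
  \<comment> \<open>The leading coefficient 1 is a constant series, so setting the variables to 0
    preserves it, and with it the degree of \<open>q\<close>.\<close>
  have "Polynomial.coeff (coeff_poly 0 q) (Polynomial.degree q) = 1"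
    using q(1) const[of 1] by (simp add: mps_const_def)
  moreover from this have "Polynomial.degree (coeff_poly 0 q) = Polynomial.degree q"
    using degree_coeff_poly[of 0 q] by (metis le_antisym Polynomial.le_degree zero_neq_one)
  ultimately have "lead_coeff (coeff_poly 0 q) = 1" by simp
  thus ?thesis
    using root poly_over_coeff_poly[OF q(2)] unfolding integral_over_def poly_over_def by blast
qed

end

section \<open>The coefficient map of a power series ring\<close>

text \<open>The coefficient map is the inverse of the given isomorphism \<open>\<iota>\<close>, and
  its properties are transported through \<open>\<iota>\<close>.\<close>

lemma power_series_coeffs_exists:
  fixes V R :: "'a::field set"
  assumes V: "subring V ring_of_type_algebra" and iso: "is_power_series_ring n V R"
  obtains \<psi> where "power_series_coeffs V R \<psi>"
proof -
  interpret V: type_subring V by (rule type_subring.intro) (rule V)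
  let ?P = "power_series_ring n V"
  interpret P: cring ?P by (rule cring_power_series_ring[OF V])
  obtain \<iota> where \<iota>: "\<iota> \<in> ring_iso ?P (ring_on R)" "\<And>v. v \<in> V \<Longrightarrow> \<iota> (mps_const v) = v"
    using iso by (auto simp: is_power_series_ring_def)
  have hom: "\<iota> \<in> ring_hom ?P (ring_on R)" and bij: "bij_betw \<iota> (carrier ?P) R"
    using \<iota>(1) by (auto simp: ring_iso_def)
  have const_mem: "mps_const v \<in> carrier ?P" if "v \<in> V" for v
    using that by (auto simp: power_series_ring_def mps_const_def)
  have VR: "V \<subseteq> R"
    using \<iota>(2) const_mem bij_betwE[OF bij] by force
  define \<psi> where "\<psi> = inv_into (carrier ?P) \<iota>"
  have \<psi>: "\<psi> r \<in> carrier ?P" "\<iota> (\<psi> r) = r" if "r \<in> R" for r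
    using that bij unfolding \<psi>_def by (auto simp: bij_betw_def inv_into_into f_inv_into_f)
  have \<psi>\<iota>: "\<psi> (\<iota> f) = f" if "f \<in> carrier ?P" for f
    using that bij unfolding \<psi>_def by (auto simp: bij_betw_def inv_into_f_f)
  \<comment> \<open>Writing sums and products in \<open>R\<close> as values of
    \<open>\<iota>\<close> also shows that \<open>R\<close> is a subring of the ambient
    field.\<close>
  have sum: "r + r' = \<iota> (\<psi> r \<oplus>\<^bsub>?P\<^esub> \<psi> r')" and prod: "r * r' = \<iota> (\<psi> r \<otimes>\<^bsub>?P\<^esub> \<psi> r')"
    if "r \<in> R" "r' \<in> R" for r r'
    using ring_hom_add[OF hom \<psi>(1)[OF that(1)] \<psi>(1)[OF that(2)]]
      ring_hom_mult[OF hom \<psi>(1)[OF that(1)] \<psi>(1)[OF that(2)]] \<psi>(2) that by simp_all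
  have closed: "r + r' \<in> R" "r * r' \<in> R" if "r \<in> R" "r' \<in> R" for r r'
    using sum[OF that] prod[OF that] \<psi>(1) that bij_betwE[OF bij] by simp_all
  have "- r \<in> R" if "r \<in> R" for r
    using closed(2)[of "- 1" r] VR that by auto
  hence R: "subring R ring_of_type_algebra"
    unfolding subring_type_algebra_iff using VR closed by auto
  have add: "\<psi> (r + r') = \<psi> r \<oplus>\<^bsub>?P\<^esub> \<psi> r'" and mult: "\<psi> (r * r') = \<psi> r \<otimes>\<^bsub>?P\<^esub> \<psi> r'"
    if "r \<in> R" "r' \<in> R" for r r'
    using sum[OF that] prod[OF that] \<psi>\<iota> \<psi>(1) that by simp_all
  have const: "\<psi> v = mps_const v" if "v \<in> V" for v
    using \<psi>\<iota>[OF const_mem[OF that]] \<iota>(2)[OF that] by simp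
  have "power_series_coeffs V R \<psi>"
  proof (rule power_series_coeffs.intro)
    show "subring V ring_of_type_algebra" "subring R ring_of_type_algebra" "V \<subseteq> R"
      by fact+
    show "\<psi> v = mps_const v" if "v \<in> V" for v using that by (rule const)
    show "\<psi> (r + r') m = \<psi> r m + \<psi> r' m" "\<psi> (r * r') = mps_mult (\<psi> r) (\<psi> r')"
      if "r \<in> R" "r' \<in> R" for r r' m
      using add[OF that] mult[OF that] by (simp_all add: power_series_ring_def)
    fix r assume r: "r \<in> R"
    show "\<psi> r m \<in> V" for m using \<psi>(1)[OF r] by (simp add: power_series_ring_def)
    assume "\<And>m. \<psi> r m = 0"
    hence "\<psi> r = \<psi> 0" using const[of 0] by (auto simp: mps_const_def)
    thus "r = 0" using \<psi>(2) r VR by (metis V.zero_closed subsetD)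
  qed
  thus thesis by (rule that)
qed

section \<open>Fraction fields and the two claims of the theorem\<close>

lemma subset_frac_field: "1 \<in> S \<Longrightarrow> S \<subseteq> frac_field S"
proof
  fix x assume "1 \<in> S" "x \<in> S"
  moreover have "x = x / 1 \<and> (1::'a) \<noteq> 0" by simp
  ultimately show "x \<in> frac_field S" unfolding frac_field_def by blast
qed

lemma algebraic_over_mono: "algebraic_over S x \<Longrightarrow> S \<subseteq> T \<Longrightarrow> algebraic_over T x"
  unfolding algebraic_over_def by blast

lemma algebraic_over_self:
  assumes "0 \<in> K" "1 \<in> K" "- x \<in> K"
  shows "algebraic_over K x"
  unfolding algebraic_over_def
  by (rule exI[of _ "[:- x, 1:]"]) (use assms in \<open>auto simp: coeff_pCons split: nat.split\<close>)

theorem proposition4p1: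
  shows
    "(\<forall>(V :: 'a::{alg_closed_field, field_char_0} set) (p :: nat) (n :: nat) R B b c.
        subring V ring_of_type_algebra \<longrightarrow>
        complete_dvr (ring_on V) \<longrightarrow>
        mixed_characteristic (ring_on V) p \<longrightarrow>
        maximalideal (PIdl\<^bsub>ring_on V\<^esub> (of_nat p)) (ring_on V) \<longrightarrow>
        1 \<le> n \<longrightarrow>
        is_power_series_ring (n - 1) V R \<longrightarrow>
        integral_ext_in_algebraic_field R B \<longrightarrow>
        c \<in> B \<longrightarrow> c \<noteq> 0 \<longrightarrow> b \<in> B - V \<longrightarrow>
        torsion_element (ring_on B) (kaehler V B) (c \<odot>\<^bsub>kaehler V B\<^esub> kaehler_d V B b) \<longrightarrow>
        b \<in> absolute_integral_closure V B \<inter> B)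
     \<and>
     (\<forall>(k :: 'b::field_char_0 set) (n :: nat) R B.
        subfield k ring_of_type_algebra \<longrightarrow>
        is_power_series_ring n k R \<or> is_polynomial_ring n k R \<longrightarrow>
        integral_ext_in_algebraic_field R B \<longrightarrow>
        (\<forall>b \<in> B - algebraic_closure_in k (frac_field B).
           torsion_free_element (ring_on B) (kaehler k B) (kaehler_d k B b)))"
proof (intro conjI allI impI ballI)
  fix V R B :: "'a set" and n :: nat and b c
  assume V: "subring V ring_of_type_algebra"
    and R: "is_power_series_ring (n - 1) V R"
    and RB: "integral_ext_in_algebraic_field R B"
    and c: "c \<in> B" "c \<noteq> 0" and b: "b \<in> B - V"
    and tors: "torsion_element (ring_on B) (kaehler V B) (c \<odot>\<^bsub>kaehler V B\<^esub> kaehler_d V B b)"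
  have B: "subring B ring_of_type_algebra" and int: "integral_over R b"
    using RB b by (auto simp: integral_ext_in_algebraic_field_def)
  interpret V: type_subring V by (rule type_subring.intro) (rule V)
  interpret B: type_subring B by (rule type_subring.intro) (rule B)
  obtain e where e: "e \<in> B" "e \<noteq> 0"
      "e \<odot>\<^bsub>kaehler V B\<^esub> (c \<odot>\<^bsub>kaehler V B\<^esub> kaehler_d V B b) = \<zero>\<^bsub>kaehler V B\<^esub>"
    using tors by (auto simp: torsion_element_def)
  \<comment> \<open>The factor \<open>c\<close> is absorbed into the annihilator;
    \<open>e * c\<close> is nonzero in a field.\<close>
  have "(e * c) \<odot>\<^bsub>kaehler V B\<^esub> kaehler_d V B b = \<zero>\<^bsub>kaehler V B\<^esub>"
    using e c by (simp add: kaehler_d_def kaehler_smult_class free_smult_simps)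
  hence alg: "algebraic_over V b"
    using e c by (intro kaehler_d_multiple_zero_imp_algebraic[OF V B, of "e * c"]) auto
  obtain \<psi> where "power_series_coeffs V R \<psi>"
    using power_series_coeffs_exists[OF V R] .
  hence "integral_over V b" using alg int by (rule power_series_coeffs.integral_over_coefficients)
  moreover have "algebraic_over (frac_field V) b"
    using alg subset_frac_field[of V] by (auto intro: algebraic_over_mono)
  \<comment> \<open>The absolute integral closure is taken inside the algebraic closure of Q(B),
    which contains \<open>b\<close> because \<open>B\<close> does.\<close>
  moreover have "algebraic_over (frac_field B) b"
    using b subset_frac_field[of B] by (intro algebraic_over_self) auto
  ultimately show "b \<in> absolute_integral_closure V B \<inter> B"
    using b by (simp add: absolute_integral_closure_def algebraic_closure_in_def)
next
  fix k R B :: "'b set" and n :: nat and b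
  assume k: "subfield k ring_of_type_algebra"
    and RB: "integral_ext_in_algebraic_field R B"
    and b: "b \<in> B - algebraic_closure_in k (frac_field B)"
  have B: "subring B ring_of_type_algebra"
    using RB by (simp add: integral_ext_in_algebraic_field_def)
  interpret B: type_subring B by (rule type_subring.intro) (rule B)
  \<comment> \<open>As \<open>b\<close> lies in Q(B), it is outside the algebraic closure of
    \<open>k\<close> there only by being transcendental over \<open>k\<close>.\<close>
  have "\<not> algebraic_over k b"
    using b subset_frac_field[of B] by (auto simp: algebraic_closure_in_def)
  thus "torsion_free_element (ring_on B) (kaehler k B) (kaehler_d k B b)"
    using kaehler_d_multiple_zero_imp_algebraic[OF subfieldE(1)[OF k] B]
    by (auto simp: torsion_free_element_def)
qed

end
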